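(* Let $P\subset\mathbb{R}^d$ be a lattice polytope of dimension $d\ge1$. For every $k\in\mathbb{N}$, $$\mathrm{mldeg}(\mathcal{A}^k(P)) = 2^k\,\mathrm{mldeg}(P).$$
   Context: $\mathcal{A}(P) := P\times[-1,1]$, and $\mathcal{A}^k(P)$ is the $(d+k)$-dimensional polytope obtained by applying $\mathcal{A}$ exactly $k$ times, with $\mathcal{A}^0(P)=P$ (so $0\in\mathbb{N}$ is allowed). For a lattice polytope $P \subset \mathbb{R}^d$ with lattice points $P\cap\mathbb{Z}^d = \{a_1,\dots,a_n\}$, the design matrix is $A = [a_1\ \cdots\ a_n] \in \mathbb{Z}^{d\times n}$, and $A'$ is $A$ with an additional first row of ones. The toric variety $V = V_A\subseteq \mathbb{C}^n$ (standard scaling) is the Zariski closure of the image of $\psi:(\mathbb{C}^* )^{d+1}\to(\mathbb{C}^* )^n$, $(s,\theta)\mapsto (s\theta^{a_1},\dots,s\theta^{a_n})$. For data $u\in\mathbb{N}^n$ with $u_+ = \sum_i u_i$, the score equations are $A'p = \frac{1}{u_+}A'u$ with $p\in V\cap(\mathbb{C}^* )^n$, and $\mathrm{mldeg}(P):=\mathrm{mldeg}(V)$ is the number of complex solutions $p$ for generic $u$. *)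

theory Defs
  imports "HOL-Analysis.Analysis" "HOL-Analysis.Finite_Function_Topology"
begin

text \<open>Since \<open>d + k\<close> varies inside a single statement, \<open>\<real>\<^sup>d\<close> is realised as the subspace of
  vectors of type \<^typ>\<open>nat \<Rightarrow>\<^sub>0 real\<close> supported in \<open>{..<d}\<close>, and similarly \<open>\<int>\<^sup>d\<close>.
  In particular \<open>\<real>\<^sup>d\<close> sits inside \<open>\<real>\<^sup>d\<^sup>+\<^sup>1\<close> as the vectors with last coordinate zero.\<close>

abbreviation of_int_vec :: "(nat \<Rightarrow>\<^sub>0 int) \<Rightarrow> (nat \<Rightarrow>\<^sub>0 real)"
  where "of_int_vec \<equiv> Poly_Mapping.map real_of_int"

definition lattice_polytope :: "nat \<Rightarrow> (nat \<Rightarrow>\<^sub>0 real) set \<Rightarrow> bool"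
  where "lattice_polytope d P \<longleftrightarrow>
    (\<exists>W. finite W \<and> (\<forall>w\<in>W. Poly_Mapping.keys w \<subseteq> {..<d}) \<and> P = convex hull (of_int_vec ` W))"

text \<open>\<^const>\<open>aff_dim\<close> is only available on Euclidean spaces; this is the property by which the
  library characterises it there.\<close>

definition has_aff_dim :: "'a::real_vector set \<Rightarrow> nat \<Rightarrow> bool"
  where "has_aff_dim P n \<longleftrightarrow>
    (\<exists>B. affine hull B = affine hull P \<and> \<not> affine_dependent B \<and> card B = n + 1)"

text \<open>\<open>P \<times> [-1,1]\<close> for \<open>P \<subseteq> \<real>\<^sup>d\<close>, the new coordinate being the one with index \<open>d\<close>.\<close>

definition prism :: "nat \<Rightarrow> (nat \<Rightarrow>\<^sub>0 real) set \<Rightarrow> (nat \<Rightarrow>\<^sub>0 real) set"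
  where "prism d P = {x + Poly_Mapping.single d t | x t. x \<in> P \<and> t \<in> {-1..1}}"

primrec iterated_prism :: "nat \<Rightarrow> nat \<Rightarrow> (nat \<Rightarrow>\<^sub>0 real) set \<Rightarrow> (nat \<Rightarrow>\<^sub>0 real) set" where
  "iterated_prism 0 d P = P"
| "iterated_prism (Suc k) d P = prism (d + k) (iterated_prism k d P)"

definition lattice_points :: "(nat \<Rightarrow>\<^sub>0 real) set \<Rightarrow> (nat \<Rightarrow>\<^sub>0 int) set"
  where "lattice_points P = {a. of_int_vec a \<in> P}"

text \<open>For a finite index set \<open>S\<close>, the affine space \<open>\<complex>\<^sup>S\<close> consists of the functions in
  \<open>S \<rightarrow>\<^sub>E UNIV\<close>. Polynomials in variables indexed by \<^typ>\<open>'v\<close> are finitely supported families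
  of coefficients, indexed by exponent vectors.\<close>

type_synonym 'v cpoly = "('v \<Rightarrow>\<^sub>0 nat) \<Rightarrow>\<^sub>0 complex"

definition cpolys_in :: "'v set \<Rightarrow> 'v cpoly set"
  where "cpolys_in S = {f. \<forall>m\<in>Poly_Mapping.keys f. Poly_Mapping.keys m \<subseteq> S}"

definition eval_cpoly :: "'v cpoly \<Rightarrow> ('v \<Rightarrow> complex) \<Rightarrow> complex"
  where "eval_cpoly f x = (\<Sum>m\<in>Poly_Mapping.keys f.
    Poly_Mapping.lookup f m * (\<Prod>v\<in>Poly_Mapping.keys m. x v ^ Poly_Mapping.lookup m v))"

definition zariski_closed :: "'v set \<Rightarrow> ('v \<Rightarrow> complex) set \<Rightarrow> bool"
  where "zariski_closed S Z \<longleftrightarrow>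
    (\<exists>F\<subseteq>cpolys_in S. Z = {x \<in> S \<rightarrow>\<^sub>E UNIV. \<forall>f\<in>F. eval_cpoly f x = 0})"

definition zariski_closure :: "'v set \<Rightarrow> ('v \<Rightarrow> complex) set \<Rightarrow> ('v \<Rightarrow> complex) set"
  where "zariski_closure S X = \<Inter>{Z. zariski_closed S Z \<and> X \<subseteq> Z}"

text \<open>The columns of the matrices \<open>A\<close> and \<open>A'\<close> are indexed by the lattice points themselves rather
  than by an enumeration of them. Row \<open>0\<close> of \<open>A'\<close> is the row of ones, and row \<open>i + 1\<close> is row \<open>i\<close>
  of \<open>A\<close>.\<close>

definition design_matrix' :: "nat \<Rightarrow> (nat \<Rightarrow>\<^sub>0 int) \<Rightarrow> int"
  where "design_matrix' i a = (case i of 0 \<Rightarrow> 1 | Suc j \<Rightarrow> Poly_Mapping.lookup a j)"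

definition monomial_map ::
  "nat \<Rightarrow> (nat \<Rightarrow>\<^sub>0 int) set \<Rightarrow> complex \<Rightarrow> (nat \<Rightarrow> complex) \<Rightarrow> (nat \<Rightarrow>\<^sub>0 int) \<Rightarrow> complex"
  where "monomial_map d S s \<theta> = (\<lambda>a\<in>S. s * (\<Prod>i<d. \<theta> i powi Poly_Mapping.lookup a i))"

definition toric_variety :: "nat \<Rightarrow> (nat \<Rightarrow>\<^sub>0 int) set \<Rightarrow> ((nat \<Rightarrow>\<^sub>0 int) \<Rightarrow> complex) set"
  where "toric_variety d S =
    zariski_closure S {monomial_map d S s \<theta> | s \<theta>. s \<noteq> 0 \<and> (\<forall>i<d. \<theta> i \<noteq> 0)}"

definition score_solutions ::
  "nat \<Rightarrow> (nat \<Rightarrow>\<^sub>0 int) set \<Rightarrow> ((nat \<Rightarrow>\<^sub>0 int) \<Rightarrow> nat) \<Rightarrow> ((nat \<Rightarrow>\<^sub>0 int) \<Rightarrow> complex) set"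
  where "score_solutions d S u =
    {p \<in> toric_variety d S. (\<forall>a\<in>S. p a \<noteq> 0) \<and>
      (\<forall>i\<le>d. (\<Sum>a\<in>S. of_int (design_matrix' i a) * p a) =
        (\<Sum>a\<in>S. of_int (design_matrix' i a) * of_nat (u a)) / of_nat (\<Sum>a\<in>S. u a))}"

text \<open>``For generic \<open>u \<in> \<nat>\<^sup>S\<close>'' means: outside a proper Zariski closed subset of \<open>\<complex>\<^sup>S\<close>.
  (The data with \<open>u\<^sub>+ = 0\<close> lie in such a subset.)\<close>

definition for_generic_data :: "'v set \<Rightarrow> (('v \<Rightarrow> nat) \<Rightarrow> bool) \<Rightarrow> bool"
  where "for_generic_data S Q \<longleftrightarrow>
    (\<exists>Z. zariski_closed S Z \<and> Z \<noteq> (S \<rightarrow>\<^sub>E UNIV) \<and>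
      (\<forall>u \<in> S \<rightarrow>\<^sub>E UNIV. (\<lambda>a\<in>S. of_nat (u a)) \<notin> Z \<longrightarrow> Q u))"

definition is_generic_score_count :: "nat \<Rightarrow> (nat \<Rightarrow>\<^sub>0 int) set \<Rightarrow> nat \<Rightarrow> bool"
  where "is_generic_score_count d S m \<longleftrightarrow>
    for_generic_data S (\<lambda>u. finite (score_solutions d S u) \<and> card (score_solutions d S u) = m)"

text \<open>The generic number of solutions exists by elimination theory, and it is unique because
  \<open>\<nat>\<^sup>S\<close> is Zariski dense in \<open>\<complex>\<^sup>S\<close>; the value \<open>0\<close> in the other branch is only a convention making
  the function total. The argument \<open>d\<close> is the dimension of the ambient space of \<open>P\<close>.\<close>

definition mldeg :: "nat \<Rightarrow> (nat \<Rightarrow>\<^sub>0 real) set \<Rightarrow> nat"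
  where "mldeg d P =
    (if \<exists>m. is_generic_score_count d (lattice_points P) m
     then THE m. is_generic_score_count d (lattice_points P) m
     else 0)"

end

theory Submission
  imports Defs "HOL-Computational_Algebra.Polynomial"
begin

text \<open>The lattice points of a prism over \<open>Q\<close> are the points \<open>(a, j)\<close> with \<open>a\<close> a lattice point of
  \<open>Q\<close> and \<open>j \<in> {-1, 0, 1}\<close>. On the torus, a point of the toric variety of the prism is
  \<open>s \<theta>\<^sup>a t\<^sup>j\<close>, so the sum over \<open>j\<close> is \<open>s (t\<^sup>-\<^sup>1 + 1 + t) \<theta>\<^sup>a\<close>, again a point of the toric
  variety of \<open>Q\<close>. All score equations of the prism but the last involve only these sums, and they are
  the score equations of \<open>Q\<close> for the marginal data \<open>u (a, -1) + u (a, 0) + u (a, 1)\<close>. Since the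
  first one gives the sums total mass \<open>1\<close>, the last one becomes an equation in \<open>t\<close> alone,
  \<open>t - t\<^sup>-\<^sup>1 = c (t\<^sup>-\<^sup>1 + 1 + t)\<close>, where \<open>c\<close> is the mean height of the data. For positive data
  \<open>\<bar>c\<bar> < 1\<close>, and the resulting quadratic has two distinct nonzero roots. So
  (\<open>score_solutions_prism\<close>) the solution set of the prism is the solution set of \<open>Q\<close> times a set of
  two elements, and an induction gives the factor \<open>2 ^ k\<close>.

  The solutions lie in the Zariski closure of the parametrised points, and the same picture holds
  there. For a point \<open>p\<close> of the closure with nonzero coordinates, the binomials \<open>p (a, 1) p (b, 0) = p (a, 0) p (b, 1)\<close> and
  \<open>p (a, 1) p (a, -1) = p (a, 0)\<^sup>2\<close> show that \<open>t = p (a, 1) / p (a, 0)\<close> does not depend on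
  \<open>a\<close> and determines \<open>p\<close> from its values at height \<open>0\<close>; and the passage between those values and
  \<open>p\<close> is linear, maps orbits to orbits, and hence closures to closures
  (\<open>toric_variety_slice\<close>, \<open>toric_variety_spread\<close>).

  The number of solutions must also be compared for generic data, in both directions, because
  \<open>mldeg\<close> takes the value \<open>0\<close> where no generic count exists: the generic counts of the prism
  are exactly the doubles of those of \<open>Q\<close>. Data that are generic for \<open>Q\<close> pull back along the marginal
  map (\<open>generic_score_count_prismI\<close>). Conversely, generic data of \<open>Q\<close> must be lifted to generic
  natural data of the prism (\<open>generic_score_count_prismD\<close>), which uses that natural points are Zariski
  dense.\<close>

section \<open>Polynomial functions in finitely many variables\<close>

text \<open>Only the functions defined by polynomials matter for Zariski closed sets, and for functions
  products and substitutions are pointwise operations.\<close>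
definition polynomial_on :: "'v set \<Rightarrow> (('v \<Rightarrow> complex) \<Rightarrow> complex) \<Rightarrow> bool"
  where "polynomial_on S g \<longleftrightarrow> g \<in> eval_cpoly ` cpolys_in S"

definition monomial_fun :: "('v \<Rightarrow>\<^sub>0 nat) \<Rightarrow> ('v \<Rightarrow> complex) \<Rightarrow> complex"
  where "monomial_fun m x = (\<Prod>v\<in>Poly_Mapping.keys m. x v ^ Poly_Mapping.lookup m v)"

lemma polynomial_onI:
  assumes "f \<in> cpolys_in S" "\<And>x. eval_cpoly f x = g x"
  shows "polynomial_on S g"
proof -
  have "g = eval_cpoly f"
    using assms(2) by auto
  then show ?thesis
    using assms(1) by (auto simp: polynomial_on_def)
qed

lemma monomial_fun_superset:
  assumes "finite V" "Poly_Mapping.keys m \<subseteq> V"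
  shows "monomial_fun m x = (\<Prod>v\<in>V. x v ^ Poly_Mapping.lookup m v)"
  unfolding monomial_fun_def
  by (rule prod.mono_neutral_left) (use assms in \<open>auto simp: in_keys_iff\<close>)

lemma monomial_fun_add: "monomial_fun (m + n) x = monomial_fun m x * monomial_fun n x"
proof -
  let ?V = "Poly_Mapping.keys m \<union> Poly_Mapping.keys n"
  have "monomial_fun (m + n) x = (\<Prod>v\<in>?V. x v ^ Poly_Mapping.lookup (m + n) v)"
    by (rule monomial_fun_superset) (use Poly_Mapping.keys_add[of m n] in auto)
  also have "\<dots> = (\<Prod>v\<in>?V. x v ^ Poly_Mapping.lookup m v) * (\<Prod>v\<in>?V. x v ^ Poly_Mapping.lookup n v)"
    by (simp add: lookup_add power_add prod.distrib)
  also have "\<dots> = monomial_fun m x * monomial_fun n x"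
    by (simp add: monomial_fun_superset[of ?V])
  finally show ?thesis .
qed

lemma eval_cpoly_superset:
  assumes "finite M" "Poly_Mapping.keys f \<subseteq> M"
  shows "eval_cpoly f x = (\<Sum>m\<in>M. Poly_Mapping.lookup f m * monomial_fun m x)"
  unfolding eval_cpoly_def monomial_fun_def
  by (rule sum.mono_neutral_left) (use assms in \<open>auto simp: in_keys_iff\<close>)

lemma eval_cpoly_eq:
  "eval_cpoly f x = (\<Sum>m\<in>Poly_Mapping.keys f. Poly_Mapping.lookup f m * monomial_fun m x)"
  by (rule eval_cpoly_superset) auto

lemma eval_cpoly_add: "eval_cpoly (f + g) x = eval_cpoly f x + eval_cpoly g x"
proof -
  let ?M = "Poly_Mapping.keys f \<union> Poly_Mapping.keys g"
  have "eval_cpoly (f + g) x = (\<Sum>m\<in>?M. Poly_Mapping.lookup (f + g) m * monomial_fun m x)"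
    by (rule eval_cpoly_superset) (use Poly_Mapping.keys_add[of f g] in auto)
  also have "\<dots> = eval_cpoly f x + eval_cpoly g x"
    by (simp add: eval_cpoly_superset[of ?M] lookup_add distrib_right sum.distrib)
  finally show ?thesis .
qed

lemma eval_cpoly_single:
  "eval_cpoly (Poly_Mapping.single m c) x = c * monomial_fun m x"
  by (subst eval_cpoly_superset[of "{m}"]) auto

lemma polynomial_on_monomial:
  "Poly_Mapping.keys m \<subseteq> S \<Longrightarrow> polynomial_on S (\<lambda>x. c * monomial_fun m x)"
  by (rule polynomial_onI[of "Poly_Mapping.single m c"])
    (auto simp: cpolys_in_def eval_cpoly_single)

lemma polynomial_on_const: "polynomial_on S (\<lambda>x. c)"
  using polynomial_on_monomial[of 0 S c] by (simp add: monomial_fun_def)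

lemma polynomial_on_var: "v \<in> S \<Longrightarrow> polynomial_on S (\<lambda>x. x v)"
  using polynomial_on_monomial[of "Poly_Mapping.single v 1" S 1] by (simp add: monomial_fun_def)

lemma polynomial_on_add:
  assumes "polynomial_on S g" "polynomial_on S h"
  shows "polynomial_on S (\<lambda>x. g x + h x)"
proof -
  obtain f f' where "f \<in> cpolys_in S" "f' \<in> cpolys_in S" "g = eval_cpoly f" "h = eval_cpoly f'"
    using assms by (auto simp: polynomial_on_def)
  then show ?thesis
    by (intro polynomial_onI[of "f + f'"])
      (use Poly_Mapping.keys_add[of f f'] in \<open>auto simp: cpolys_in_def eval_cpoly_add\<close>)
qed

lemma polynomial_on_sum:
  assumes "\<And>i. i \<in> I \<Longrightarrow> polynomial_on S (g i)"
  shows "polynomial_on S (\<lambda>x. \<Sum>i\<in>I. g i x)"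
  using assms
  by (induction I rule: infinite_finite_induct) (auto intro: polynomial_on_const polynomial_on_add)

lemma polynomial_on_expansion:
  assumes "polynomial_on S g"
  obtains M c where "finite M" "\<And>m. m \<in> M \<Longrightarrow> Poly_Mapping.keys m \<subseteq> S"
    "\<And>x. g x = (\<Sum>m\<in>M. c m * monomial_fun m x)"
proof -
  obtain f where "f \<in> cpolys_in S" "g = eval_cpoly f"
    using assms by (auto simp: polynomial_on_def)
  then show thesis
    by (intro that[of "Poly_Mapping.keys f" "Poly_Mapping.lookup f"])
      (auto simp: cpolys_in_def eval_cpoly_eq)
qed

lemma polynomial_on_mult:
  assumes "polynomial_on S g" "polynomial_on S h"
  shows "polynomial_on S (\<lambda>x. g x * h x)"
proof -
  obtain M c where M: "\<And>m. m \<in> M \<Longrightarrow> Poly_Mapping.keys m \<subseteq> S"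
    "\<And>x. g x = (\<Sum>m\<in>M. c m * monomial_fun m x)"
    using polynomial_on_expansion[OF assms(1)] by metis
  obtain N e where N: "\<And>m. m \<in> N \<Longrightarrow> Poly_Mapping.keys m \<subseteq> S"
    "\<And>x. h x = (\<Sum>m\<in>N. e m * monomial_fun m x)"
    using polynomial_on_expansion[OF assms(2)] by metis
  have "(\<lambda>x. g x * h x) = (\<lambda>x. \<Sum>m\<in>M. \<Sum>n\<in>N. (c m * e n) * monomial_fun (m + n) x)"
    by (simp add: M(2) N(2) sum_product monomial_fun_add mult_ac)
  moreover have "Poly_Mapping.keys (m + n) \<subseteq> S" if "m \<in> M" "n \<in> N" for m n
    using that M(1) N(1) Poly_Mapping.keys_add[of m n] by blast
  ultimately show ?thesis
    by (auto intro!: polynomial_on_sum polynomial_on_monomial)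
qed

lemma polynomial_on_prod:
  assumes "\<And>i. i \<in> I \<Longrightarrow> polynomial_on S (g i)"
  shows "polynomial_on S (\<lambda>x. \<Prod>i\<in>I. g i x)"
  using assms
  by (induction I rule: infinite_finite_induct) (auto intro: polynomial_on_const polynomial_on_mult)

lemma polynomial_on_power:
  assumes "polynomial_on S g"
  shows "polynomial_on S (\<lambda>x. g x ^ n)"
  by (induction n) (auto intro: polynomial_on_const polynomial_on_mult assms)

lemma polynomial_on_diff:
  assumes "polynomial_on S g" "polynomial_on S h"
  shows "polynomial_on S (\<lambda>x. g x - h x)"
  using polynomial_on_add[OF assms(1) polynomial_on_mult[OF polynomial_on_const[of S "-1"] assms(2)]]
  by simp

lemmas polynomial_on_intros =
  polynomial_on_const polynomial_on_var polynomial_on_add polynomial_on_diff polynomial_on_mult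
  polynomial_on_sum polynomial_on_prod polynomial_on_power

lemma polynomial_on_compose:
  assumes "polynomial_on S' g" "\<And>v. v \<in> S' \<Longrightarrow> polynomial_on S (\<phi> v)"
  shows "polynomial_on S (\<lambda>x. g (\<lambda>v. \<phi> v x))"
proof -
  obtain M c where M: "\<And>m. m \<in> M \<Longrightarrow> Poly_Mapping.keys m \<subseteq> S'"
    "\<And>x. g x = (\<Sum>m\<in>M. c m * monomial_fun m x)"
    using polynomial_on_expansion[OF assms(1)] by metis
  show ?thesis
    unfolding M(2) monomial_fun_def
    by (intro polynomial_on_intros assms(2)) (use M(1) in blast)
qed

lemma polynomial_on_cong:
  assumes "polynomial_on S g" "\<And>v. v \<in> S \<Longrightarrow> x v = y v"
  shows "g x = g y"
proof -
  obtain M c where M: "\<And>m. m \<in> M \<Longrightarrow> Poly_Mapping.keys m \<subseteq> S"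
    "\<And>x. g x = (\<Sum>m\<in>M. c m * monomial_fun m x)"
    using polynomial_on_expansion[OF assms(1)] by metis
  have "monomial_fun m x = monomial_fun m y" if "m \<in> M" for m
    unfolding monomial_fun_def by (rule prod.cong) (use M(1)[OF that] assms(2) in auto)
  then show ?thesis
    by (simp add: M(2))
qed

text \<open>Along a polynomial curve a polynomial function becomes a univariate polynomial, for which
  there are only finitely many roots. All statements about nonvanishing below come from this.\<close>
lemma polynomial_on_curve:
  fixes q :: "'v \<Rightarrow> complex poly"
  assumes "polynomial_on S g"
  shows "\<exists>r. \<forall>t. g (\<lambda>v. poly (q v) t) = poly r t"
proof -
  obtain M c where M: "\<And>x. g x = (\<Sum>m\<in>M. c m * monomial_fun m x)"
    using polynomial_on_expansion[OF assms] by metis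
  define r where "r = (\<Sum>m\<in>M. smult (c m) (\<Prod>v\<in>Poly_Mapping.keys m. q v ^ Poly_Mapping.lookup m v))"
  have "g (\<lambda>v. poly (q v) t) = poly r t" for t
    by (simp add: M r_def monomial_fun_def poly_sum poly_prod)
  then show ?thesis
    by blast
qed

section \<open>Zariski density of the natural points\<close>

lemma exists_nat_nonroot:
  fixes q :: "complex poly"
  assumes "q \<noteq> 0"
  shows "\<exists>n. poly q (of_nat n) \<noteq> 0"
proof (rule ccontr)
  assume "\<not> ?thesis"
  then have "range (of_nat :: nat \<Rightarrow> complex) \<subseteq> {x. poly q x = 0}"
    by auto
  then have "finite (range (of_nat :: nat \<Rightarrow> complex))"
    using poly_roots_finite[OF assms] finite_subset by blast
  then show False
    by (simp add: finite_image_iff inj_of_nat)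
qed

text \<open>This is the irreducibility of affine space. On the line through \<open>x\<close> and \<open>y\<close> both functions
  are nonzero univariate polynomials, and the polynomial ring in one variable is a domain.\<close>
lemma polynomial_on_mult_nonzero:
  assumes "polynomial_on S g" "polynomial_on S h" "g x \<noteq> 0" "h y \<noteq> 0"
  shows "\<exists>z. g z * h z \<noteq> 0"
proof -
  define q where "q v = [:x v, y v - x v:]" for v
  obtain r where r: "g (\<lambda>v. poly (q v) t) = poly r t" for t
    using polynomial_on_curve[OF assms(1)] by blast
  obtain s where s: "h (\<lambda>v. poly (q v) t) = poly s t" for t
    using polynomial_on_curve[OF assms(2)] by blast
  have "poly r 0 \<noteq> 0" "poly s 1 \<noteq> 0"
    using r[of 0] s[of 1] assms(3,4) by (auto simp: q_def)
  then have "r * s \<noteq> 0"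
    by auto
  then obtain n where "poly (r * s) (of_nat n) \<noteq> 0"
    using exists_nat_nonroot[of "r * s"] by blast
  then show ?thesis
    by (metis poly_mult r s)
qed

text \<open>The coordinates can be moved to natural numbers one at a time: in each of them the function
  is a univariate polynomial that is not zero, so only finitely many values are forbidden.\<close>
lemma polynomial_on_nat_point:
  assumes "finite S" "polynomial_on S g" "g x \<noteq> 0"
  obtains u :: "'v \<Rightarrow> nat" where "u \<in> S \<rightarrow>\<^sub>E UNIV" "g (\<lambda>v. of_nat (u v)) \<noteq> 0"
proof -
  have "\<exists>y. (\<forall>v\<in>T. y v \<in> range of_nat) \<and> g y \<noteq> 0" if "finite T" for T
    using that
  proof (induction T)
    case empty
    then show ?case
      using assms(3) by auto
  next
    case (insert a T)
    then obtain y where y: "\<forall>v\<in>T. y v \<in> range of_nat" "g y \<noteq> 0"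
      by auto
    define q where "q v = (if v = a then [:0, 1:] else [:y v:])" for v
    obtain r where r: "g (\<lambda>v. poly (q v) t) = poly r t" for t
      using polynomial_on_curve[OF assms(2)] by blast
    have q: "(\<lambda>v. poly (q v) t) = y(a := t)" for t
      by (auto simp: q_def)
    have "poly r (y a) \<noteq> 0"
      using r[of "y a"] y(2) by (simp add: q)
    then obtain n where "poly r (of_nat n) \<noteq> 0"
      using exists_nat_nonroot[of r] by (metis poly_0)
    then have "g (y(a := of_nat n)) \<noteq> 0"
      using r[of "of_nat n"] by (simp add: q)
    then show ?case
      using y(1) by (intro exI[of _ "y(a := of_nat n)"]) (simp add: fun_upd_def)
  qed
  then obtain y where y: "\<forall>v\<in>S. \<exists>n. y v = of_nat n" "g y \<noteq> 0"
    using assms(1) by (meson imageE)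
  then obtain n where n: "\<forall>v\<in>S. y v = of_nat (n v)"
    by metis
  have "g (\<lambda>v. of_nat ((\<lambda>v\<in>S. n v) v)) = g y"
    by (rule polynomial_on_cong[OF assms(2)]) (use n in auto)
  then show thesis
    using y(2) by (intro that[of "\<lambda>v\<in>S. n v"]) auto
qed

text \<open>One polynomial that does not vanish identically suffices to describe genericity, since a
  proper closed set lies in the zero set of one of its equations.\<close>
lemma for_generic_data_iff:
  "for_generic_data S Q \<longleftrightarrow> (\<exists>g. polynomial_on S g \<and> (\<exists>x. g x \<noteq> 0) \<and>
     (\<forall>u \<in> S \<rightarrow>\<^sub>E UNIV. g (\<lambda>a. of_nat (u a)) \<noteq> 0 \<longrightarrow> Q u))" (is "_ \<longleftrightarrow> ?R")
proof
  assume "for_generic_data S Q"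
  then obtain Z where Z: "zariski_closed S Z" "Z \<noteq> (S \<rightarrow>\<^sub>E UNIV)"
    "\<And>u. u \<in> S \<rightarrow>\<^sub>E UNIV \<Longrightarrow> (\<lambda>a\<in>S. of_nat (u a)) \<notin> Z \<Longrightarrow> Q u"
    by (auto simp: for_generic_data_def)
  obtain F where F: "F \<subseteq> cpolys_in S" "Z = {x \<in> S \<rightarrow>\<^sub>E UNIV. \<forall>f\<in>F. eval_cpoly f x = 0}"
    using Z(1) by (auto simp: zariski_closed_def)
  obtain f x where f: "f \<in> F" "eval_cpoly f x \<noteq> 0"
    using Z(2) F(2) by auto
  have p: "polynomial_on S (eval_cpoly f)"
    using f(1) F(1) by (auto simp: polynomial_on_def)
  have "Q u" if "u \<in> S \<rightarrow>\<^sub>E UNIV" "eval_cpoly f (\<lambda>a. of_nat (u a)) \<noteq> 0" for u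
  proof (rule Z(3)[OF that(1)])
    have "eval_cpoly f (\<lambda>a\<in>S. of_nat (u a)) = eval_cpoly f (\<lambda>a. of_nat (u a))"
      by (rule polynomial_on_cong[OF p]) auto
    then show "(\<lambda>a\<in>S. of_nat (u a)) \<notin> Z"
      using that(2) f(1) F(2) by auto
  qed
  then show ?R
    using p f(2) by blast
next
  assume ?R
  then obtain g x where g: "polynomial_on S g" "g x \<noteq> 0"
    "\<And>u. u \<in> S \<rightarrow>\<^sub>E UNIV \<Longrightarrow> g (\<lambda>a. of_nat (u a)) \<noteq> 0 \<Longrightarrow> Q u"
    by auto
  obtain f where f: "f \<in> cpolys_in S" "g = eval_cpoly f"
    using g(1) by (auto simp: polynomial_on_def)
  define Z where "Z = {x \<in> S \<rightarrow>\<^sub>E UNIV. g x = 0}"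
  have restr: "g (restrict y S) = g y" for y
    by (rule polynomial_on_cong[OF g(1)]) auto
  have "zariski_closed S Z"
    unfolding zariski_closed_def Z_def using f by (intro exI[of _ "{f}"]) auto
  moreover have "restrict x S \<notin> Z"
    using g(2) by (simp add: Z_def restr)
  then have "Z \<noteq> (S \<rightarrow>\<^sub>E UNIV)"
    by auto
  moreover have "Q u" if "u \<in> S \<rightarrow>\<^sub>E UNIV" "(\<lambda>a\<in>S. of_nat (u a)) \<notin> Z" for u
    using that g(3) by (auto simp: Z_def restr)
  ultimately show "for_generic_data S Q"
    unfolding for_generic_data_def by blast
qed

text \<open>Two dense open conditions on the data have a common natural solution.\<close>
lemma generic_score_count_unique:
  assumes "finite S" "is_generic_score_count d S m" "is_generic_score_count d S n"
  shows "m = n"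
proof -
  obtain g x where g: "polynomial_on S g" "g x \<noteq> 0"
    "\<And>u. u \<in> S \<rightarrow>\<^sub>E UNIV \<Longrightarrow> g (\<lambda>a. of_nat (u a)) \<noteq> 0 \<Longrightarrow> card (score_solutions d S u) = m"
    using assms(2) unfolding is_generic_score_count_def for_generic_data_iff by blast
  obtain h y where h: "polynomial_on S h" "h y \<noteq> 0"
    "\<And>u. u \<in> S \<rightarrow>\<^sub>E UNIV \<Longrightarrow> h (\<lambda>a. of_nat (u a)) \<noteq> 0 \<Longrightarrow> card (score_solutions d S u) = n"
    using assms(3) unfolding is_generic_score_count_def for_generic_data_iff by blast
  obtain z where "g z * h z \<noteq> 0"
    using polynomial_on_mult_nonzero[OF g(1) h(1), OF g(2) h(2)] by blast
  then obtain u :: "_ \<Rightarrow> nat" where "u \<in> S \<rightarrow>\<^sub>E UNIV" "g (\<lambda>a. of_nat (u a)) * h (\<lambda>a. of_nat (u a)) \<noteq> 0"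
    by (rule polynomial_on_nat_point[OF assms(1) polynomial_on_mult[OF g(1) h(1)]])
  then show ?thesis
    using g(3)[of u] h(3)[of u] by simp
qed

section \<open>Zariski closures and polynomial maps\<close>

lemma zariski_closure_iff:
  assumes "X \<subseteq> S \<rightarrow>\<^sub>E UNIV"
  shows "x \<in> zariski_closure S X \<longleftrightarrow>
    x \<in> S \<rightarrow>\<^sub>E UNIV \<and> (\<forall>g. polynomial_on S g \<and> (\<forall>y\<in>X. g y = 0) \<longrightarrow> g x = 0)" (is "_ \<longleftrightarrow> ?R")
proof
  assume x: "x \<in> zariski_closure S X"
  define F where "F = {f \<in> cpolys_in S. \<forall>y\<in>X. eval_cpoly f y = 0}"
  define Z where "Z = {x \<in> S \<rightarrow>\<^sub>E UNIV. \<forall>f\<in>F. eval_cpoly f x = 0}"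
  have "zariski_closed S Z"
    unfolding zariski_closed_def Z_def by (intro exI[of _ F]) (auto simp: F_def)
  moreover have "X \<subseteq> Z"
    using assms by (auto simp: Z_def F_def)
  ultimately have "x \<in> Z"
    using x by (auto simp: zariski_closure_def)
  then show ?R
    by (auto simp: Z_def F_def polynomial_on_def)
next
  assume R: ?R
  have "x \<in> Z" if Z: "zariski_closed S Z" "X \<subseteq> Z" for Z
  proof -
    obtain F where F: "F \<subseteq> cpolys_in S" "Z = {x \<in> S \<rightarrow>\<^sub>E UNIV. \<forall>f\<in>F. eval_cpoly f x = 0}"
      using Z(1) by (auto simp: zariski_closed_def)
    have "eval_cpoly f x = 0" if "f \<in> F" for f
      using R that F Z(2) unfolding polynomial_on_def by blast
    then show ?thesis
      using R F(2) by auto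
  qed
  then show "x \<in> zariski_closure S X"
    by (auto simp: zariski_closure_def)
qed

text \<open>Polynomial maps are continuous for the Zariski topology: an equation for the image of \<open>X\<close> pulls
  back to an equation for \<open>X\<close>.\<close>
lemma zariski_closure_polynomial_map:
  assumes "X \<subseteq> S \<rightarrow>\<^sub>E UNIV" "X' \<subseteq> S' \<rightarrow>\<^sub>E UNIV"
    and "\<And>b. b \<in> S' \<Longrightarrow> polynomial_on S (\<phi> b)"
    and "\<And>x. x \<in> X \<Longrightarrow> (\<lambda>b\<in>S'. \<phi> b x) \<in> X'"
    and "x \<in> zariski_closure S X"
  shows "(\<lambda>b\<in>S'. \<phi> b x) \<in> zariski_closure S' X'"
proof -
  have "g (\<lambda>b\<in>S'. \<phi> b x) = 0" if g: "polynomial_on S' g" "\<forall>y\<in>X'. g y = 0" for g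
  proof -
    have restr: "g (\<lambda>b\<in>S'. \<phi> b y) = g (\<lambda>b. \<phi> b y)" for y
      by (rule polynomial_on_cong[OF g(1)]) auto
    have "polynomial_on S (\<lambda>y. g (\<lambda>b. \<phi> b y))"
      by (rule polynomial_on_compose[OF g(1) assms(3)])
    moreover have "g (\<lambda>b. \<phi> b y) = 0" if "y \<in> X" for y
      using g(2) assms(4)[OF that] by (metis restr)
    ultimately show ?thesis
      using assms(5) unfolding zariski_closure_iff[OF assms(1)] restr by blast
  qed
  then show ?thesis
    unfolding zariski_closure_iff[OF assms(2)] by auto
qed

lemma monomial_orbit_subset:
  "{monomial_map d S s \<theta> | s \<theta>. s \<noteq> 0 \<and> (\<forall>i<d. \<theta> i \<noteq> 0)} \<subseteq> S \<rightarrow>\<^sub>E UNIV"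
  by (auto simp: monomial_map_def)

lemma toric_variety_extensional: "x \<in> toric_variety d S \<Longrightarrow> x \<in> S \<rightarrow>\<^sub>E UNIV"
  unfolding toric_variety_def by (simp only: zariski_closure_iff[OF monomial_orbit_subset])

lemma polynomial_vanishes_on_toric_variety:
  assumes "x \<in> toric_variety d S" "polynomial_on S g"
    and "\<And>s \<theta>. s \<noteq> 0 \<Longrightarrow> \<forall>i<d. \<theta> i \<noteq> 0 \<Longrightarrow> g (monomial_map d S s \<theta>) = 0"
  shows "g x = 0"
proof -
  have "\<forall>y\<in>{monomial_map d S s \<theta> | s \<theta>. s \<noteq> 0 \<and> (\<forall>i<d. \<theta> i \<noteq> 0)}. g y = 0"
    using assms(3) by auto
  then show ?thesis
    using assms(1,2) unfolding toric_variety_def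
    by (simp only: zariski_closure_iff[OF monomial_orbit_subset])
qed

text \<open>To map one toric variety into another it is enough to map the monomial parametrisation of the
  first into that of the second.\<close>
lemma toric_variety_polynomial_map:
  assumes "\<And>b. b \<in> S' \<Longrightarrow> polynomial_on S (\<phi> b)"
    and "\<And>s \<theta>. s \<noteq> 0 \<Longrightarrow> (\<forall>i<d. \<theta> i \<noteq> 0) \<Longrightarrow>
      \<exists>s' \<theta>'. s' \<noteq> 0 \<and> (\<forall>i<d'. \<theta>' i \<noteq> 0) \<and>
        (\<forall>b\<in>S'. \<phi> b (monomial_map d S s \<theta>) = monomial_map d' S' s' \<theta>' b)"
    and "x \<in> toric_variety d S"
  shows "(\<lambda>b\<in>S'. \<phi> b x) \<in> toric_variety d' S'"
proof -
  have "(\<lambda>b\<in>S'. \<phi> b y) \<in> {monomial_map d' S' s \<theta> | s \<theta>. s \<noteq> 0 \<and> (\<forall>i<d'. \<theta> i \<noteq> 0)}"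
    if y: "y \<in> {monomial_map d S s \<theta> | s \<theta>. s \<noteq> 0 \<and> (\<forall>i<d. \<theta> i \<noteq> 0)}" for y
  proof -
    obtain s \<theta> where "y = monomial_map d S s \<theta>" "s \<noteq> 0" "\<forall>i<d. \<theta> i \<noteq> 0"
      using y by auto
    then obtain s' \<theta>' where *: "s' \<noteq> 0" "\<forall>i<d'. \<theta>' i \<noteq> 0"
      "\<forall>b\<in>S'. \<phi> b y = monomial_map d' S' s' \<theta>' b"
      using assms(2)[of s \<theta>] by auto
    then have "(\<lambda>b\<in>S'. \<phi> b y) = monomial_map d' S' s' \<theta>'"
      by (auto simp: monomial_map_def)
    then show ?thesis
      using * by blast
  qed
  then show ?thesis
    using assms(1,3) unfolding toric_variety_def
    by (intro zariski_closure_polynomial_map[OF monomial_orbit_subset monomial_orbit_subset]) auto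
qed

section \<open>The toric variety of a prism\<close>

definition prism_point :: "nat \<Rightarrow> (nat \<Rightarrow>\<^sub>0 int) \<Rightarrow> int \<Rightarrow> (nat \<Rightarrow>\<^sub>0 int)"
  where "prism_point d a j = a + Poly_Mapping.single d j"

definition prism_points :: "nat \<Rightarrow> (nat \<Rightarrow>\<^sub>0 int) set \<Rightarrow> (nat \<Rightarrow>\<^sub>0 int) set"
  where "prism_points d S = {prism_point d a j | a j. a \<in> S \<and> j \<in> {-1, 0, 1}}"

locale prism_base =
  fixes d :: nat and S :: "(nat \<Rightarrow>\<^sub>0 int) set"
  assumes finite_base: "finite S"
    and nonempty_base: "S \<noteq> {}"
    and keys_base: "a \<in> S \<Longrightarrow> Poly_Mapping.keys a \<subseteq> {..<d}"
begin

abbreviation pt :: "(nat \<Rightarrow>\<^sub>0 int) \<Rightarrow> int \<Rightarrow> (nat \<Rightarrow>\<^sub>0 int)"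
  where "pt \<equiv> prism_point d"

abbreviation height :: "(nat \<Rightarrow>\<^sub>0 int) \<Rightarrow> int"
  where "height b \<equiv> Poly_Mapping.lookup b d"

definition base :: "(nat \<Rightarrow>\<^sub>0 int) \<Rightarrow> (nat \<Rightarrow>\<^sub>0 int)"
  where "base b = b - Poly_Mapping.single d (height b)"

abbreviation S' :: "(nat \<Rightarrow>\<^sub>0 int) set"
  where "S' \<equiv> prism_points d S"

lemma lookup_pt: "i < d \<Longrightarrow> Poly_Mapping.lookup (pt a j) i = Poly_Mapping.lookup a i"
  by (simp add: prism_point_def lookup_add lookup_single)

lemma height_pt [simp]: "a \<in> S \<Longrightarrow> height (pt a j) = j"
  using keys_base[of a] by (auto simp: prism_point_def lookup_add in_keys_iff)

lemma base_pt [simp]: "a \<in> S \<Longrightarrow> base (pt a j) = a"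
  using height_pt[of a j] by (simp add: base_def) (simp add: prism_point_def)

lemma pt_in [simp]: "a \<in> S \<Longrightarrow> pt a (-1) \<in> S'" "a \<in> S \<Longrightarrow> pt a 0 \<in> S'" "a \<in> S \<Longrightarrow> pt a 1 \<in> S'"
  unfolding prism_points_def by blast+

lemma prism_points_cases [consumes 1, case_names down mid up]:
  assumes "b \<in> S'"
  obtains a where "a \<in> S" "b = pt a (-1)" | a where "a \<in> S" "b = pt a 0" | a where "a \<in> S" "b = pt a 1"
  using assms unfolding prism_points_def by blast

lemma finite_prism_points: "finite S'"
proof -
  have "S' = (\<lambda>(a, j). pt a j) ` (S \<times> {-1, 0, 1})"
    by (auto simp: prism_points_def)
  then show ?thesis
    using finite_base by simp
qed

lemma base_in: "b \<in> S' \<Longrightarrow> base b \<in> S"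
  by (erule prism_points_cases) simp_all

lemma sum_prism_points:
  fixes F :: "(nat \<Rightarrow>\<^sub>0 int) \<Rightarrow> 'b::comm_monoid_add"
  shows "(\<Sum>b\<in>S'. F b) = (\<Sum>a\<in>S. F (pt a (-1)) + F (pt a 0) + F (pt a 1))"
proof -
  have "(\<Sum>b\<in>S'. F b) = (\<Sum>(a, j)\<in>S \<times> {-1, 0, 1}. F (pt a j))"
    by (rule sum.reindex_bij_witness[of _ "\<lambda>(a, j). pt a j" "\<lambda>b. (base b, height b)"])
      (auto elim!: prism_points_cases simp: prism_points_def)
  also have "\<dots> = (\<Sum>a\<in>S. \<Sum>j\<in>{-1, 0, 1}. F (pt a j))"
    by (rule sum.cartesian_product [symmetric])
  finally show ?thesis
    by (simp add: add.assoc split_def)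
qed

lemma monomial_map_prism:
  assumes "a \<in> S" "pt a j \<in> S'"
  shows "monomial_map (Suc d) S' s \<theta> (pt a j) = monomial_map d S s \<theta> a * \<theta> d powi j"
  using assms by (simp add: monomial_map_def lookup_pt mult.assoc)

text \<open>The points at height \<open>0\<close> see the parameters \<open>s\<close>, \<open>\<theta>\<^sub>0, \<dots>, \<theta>\<^sub>d\<^sub>-\<^sub>1\<close> only, and the factor
  \<open>c\<close> can be absorbed in \<open>s\<close>.\<close>
lemma toric_variety_slice:
  assumes "p \<in> toric_variety (Suc d) S'" "c \<noteq> 0"
  shows "(\<lambda>a\<in>S. c * p (pt a 0)) \<in> toric_variety d S"
proof (rule toric_variety_polynomial_map[OF _ _ assms(1), of S "\<lambda>a x. c * x (pt a 0)"])
  show "polynomial_on S' (\<lambda>x. c * x (pt a 0))" if "a \<in> S" for a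
    by (intro polynomial_on_intros) (use that in simp)
  fix s :: complex and \<theta> assume *: "s \<noteq> 0" "\<forall>i<Suc d. \<theta> i \<noteq> (0::complex)"
  have "c * monomial_map (Suc d) S' s \<theta> (pt a 0) = monomial_map d S (c * s) \<theta> a" if "a \<in> S" for a
    using monomial_map_prism[OF that pt_in(2)[OF that]] that by (simp add: monomial_map_def)
  then show "\<exists>s' \<theta>'. s' \<noteq> 0 \<and> (\<forall>i<d. \<theta>' i \<noteq> 0) \<and>
      (\<forall>a\<in>S. c * monomial_map (Suc d) S' s \<theta> (pt a 0) = monomial_map d S s' \<theta>' a)"
    using * assms(2) by (intro exI[of _ "c * s"] exI[of _ \<theta>]) auto
qed

text \<open>The inverse construction: \<open>t\<close> is the value of the new torus coordinate, and \<open>c\<close> will be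
  chosen to normalise the total mass.\<close>
definition spread :: "complex \<Rightarrow> complex \<Rightarrow> ((nat \<Rightarrow>\<^sub>0 int) \<Rightarrow> complex) \<Rightarrow> (nat \<Rightarrow>\<^sub>0 int) \<Rightarrow> complex"
  where "spread c t p = (\<lambda>b\<in>S'. c * p (base b) * t powi height b)"

lemma spread_pt [simp]:
  "a \<in> S \<Longrightarrow> spread c t p (pt a (-1)) = c * p a * inverse t"
  "a \<in> S \<Longrightarrow> spread c t p (pt a 0) = c * p a"
  "a \<in> S \<Longrightarrow> spread c t p (pt a 1) = c * p a * t"
  by (simp_all add: spread_def)

lemma toric_variety_spread:
  assumes "p \<in> toric_variety d S" "c \<noteq> 0" "t \<noteq> 0"
  shows "spread c t p \<in> toric_variety (Suc d) S'"
  unfolding spread_def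
proof (rule toric_variety_polynomial_map[OF _ _ assms(1), of S' "\<lambda>b x. c * x (base b) * t powi height b"])
  show "polynomial_on S (\<lambda>x. c * x (base b) * t powi height b)" if "b \<in> S'" for b
    by (intro polynomial_on_intros) (rule base_in[OF that])
  fix s :: complex and \<theta> assume *: "s \<noteq> 0" "\<forall>i<d. \<theta> i \<noteq> (0::complex)"
  have scale: "monomial_map d S (c * s) (\<theta>(d := t)) a = c * monomial_map d S s \<theta> a" if "a \<in> S" for a
    using that by (simp add: monomial_map_def)
  have "c * monomial_map d S s \<theta> (base b) * t powi height b
      = monomial_map (Suc d) S' (c * s) (\<theta>(d := t)) b" if "b \<in> S'" for b
    by (rule prism_points_cases[OF that]) (simp_all add: monomial_map_prism scale)
  then show "\<exists>s' \<theta>'. s' \<noteq> 0 \<and> (\<forall>i<Suc d. \<theta>' i \<noteq> 0) \<and>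
      (\<forall>b\<in>S'. c * monomial_map d S s \<theta> (base b) * t powi height b = monomial_map (Suc d) S' s' \<theta>' b)"
    using * assms(2,3) by (intro exI[of _ "c * s"] exI[of _ "\<theta>(d := t)"]) auto
qed

text \<open>These equations hold on the parametrised points, hence on the closure. They say that the
  ratio between consecutive heights is the same everywhere, so that every point of the toric variety
  without zero coordinates has a well-defined new torus coordinate.\<close>
lemma toric_variety_prism_binomials:
  assumes "p \<in> toric_variety (Suc d) S'" "a \<in> S" "b \<in> S"
  shows "p (pt a 1) * p (pt b 0) = p (pt a 0) * p (pt b 1)"
    and "p (pt a 1) * p (pt a (-1)) = p (pt a 0) ^ 2"
proof -
  have vanish: "g p = 0" if "polynomial_on S' g"
    "\<And>s \<theta>. s \<noteq> 0 \<Longrightarrow> \<theta> d \<noteq> 0 \<Longrightarrow> g (monomial_map (Suc d) S' s \<theta>) = 0" for g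
    by (rule polynomial_vanishes_on_toric_variety[OF assms(1) that(1)]) (use that(2) in simp)
  note mm = monomial_map_prism[OF assms(2)] monomial_map_prism[OF assms(3)]
  have "p (pt a 1) * p (pt b 0) - p (pt a 0) * p (pt b 1) = 0"
    by (rule vanish[of "\<lambda>p. p (pt a 1) * p (pt b 0) - p (pt a 0) * p (pt b 1)"])
      (auto intro!: polynomial_on_intros simp: assms mm)
  then show "p (pt a 1) * p (pt b 0) = p (pt a 0) * p (pt b 1)"
    by simp
  have "p (pt a 1) * p (pt a (-1)) - p (pt a 0) ^ 2 = 0"
    by (rule vanish[of "\<lambda>p. p (pt a 1) * p (pt a (-1)) - p (pt a 0) ^ 2"])
      (auto intro!: polynomial_on_intros simp: assms mm power2_eq_square)
  then show "p (pt a 1) * p (pt a (-1)) = p (pt a 0) ^ 2"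
    by simp
qed

end

section \<open>Score equations of a prism\<close>

lemma score_solutions_iff:
  assumes "0 < (\<Sum>a\<in>S. u a)"
  shows "p \<in> score_solutions d S u \<longleftrightarrow> p \<in> toric_variety d S \<and> (\<forall>a\<in>S. p a \<noteq> 0) \<and>
    (\<Sum>a\<in>S. p a) = 1 \<and>
    (\<forall>j<d. (\<Sum>a\<in>S. of_int (Poly_Mapping.lookup a j) * p a) =
      (\<Sum>a\<in>S. of_int (Poly_Mapping.lookup a j) * of_nat (u a)) / of_nat (\<Sum>a\<in>S. u a))"
proof -
  have N: "(\<Sum>a\<in>S. of_nat (u a)) / of_nat (\<Sum>a\<in>S. u a) = (1::complex)"
    using assms by (metis divide_self neq0_conv of_nat_eq_0_iff of_nat_sum)
  show ?thesis
    unfolding score_solutions_def less_Suc_eq_le[symmetric] All_less_Suc2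
    using N by (simp add: design_matrix'_def)
qed

text \<open>These are the solutions of the last score equation of a prism for data of mean height \<open>c\<close>:
  a mass distributed over the heights \<open>-1, 0, 1\<close> in proportion \<open>t\<^sup>-\<^sup>1 : 1 : t\<close> has mean height
  \<open>(t - t\<^sup>-\<^sup>1) / (1 + t + t\<^sup>-\<^sup>1)\<close>.\<close>
definition tilts :: "real \<Rightarrow> complex set"
  where "tilts c = {t. t \<noteq> 0 \<and> t - inverse t = of_real c * (1 + t + inverse t)}"

lemma tilts_nonzero: "t \<in> tilts c \<Longrightarrow> t \<noteq> 0"
  by (simp add: tilts_def)

lemma tilts_mass_nonzero:
  assumes "t \<in> tilts c"
  shows "1 + t + inverse t \<noteq> 0"
proof
  assume *: "1 + t + inverse t = 0"
  then have "t = inverse t"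
    using assms by (simp add: tilts_def)
  then have "2 * t = -1" "t * t = 1"
    using * tilts_nonzero[OF assms] by (metis add.assoc add_eq_0_iff mult_2, metis right_inverse)
  moreover have "(2 * t) * (2 * t) = 4 * (t * t)"
    by simp
  ultimately show False
    by simp
qed

text \<open>After multiplication with \<open>t\<close> the equation is
  \<open>(1 - c) t\<^sup>2 - c t - (1 + c) = 0\<close>. Its discriminant \<open>4 - 3 c\<^sup>2\<close> is positive and its constant term is
  not zero.\<close>
lemma card_tilts:
  assumes "\<bar>c\<bar> < 1"
  shows "card (tilts c) = 2"
proof -
  \<comment> \<open>\<open>D\<close> is the discriminant, and \<open>r\<close>, \<open>s\<close> are the two real roots.\<close>
  define D where "D = 4 - 3 * c\<^sup>2"
  have "c\<^sup>2 < 1"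
    using assms by (simp add: abs_square_less_1)
  then have D: "D > 0"
    by (simp add: D_def)
  have c: "1 - c > 0" "1 + c > 0"
    using assms by auto
  define r where "r = (c + sqrt D) / (2 * (1 - c))"
  define s where "s = (c - sqrt D) / (2 * (1 - c))"
  have "r \<noteq> s"
    using c D by (simp add: r_def s_def field_simps)
  have 2: "2 * (1 - c) * r = c + sqrt D" "2 * (1 - c) * s = c - sqrt D"
    using c by (simp_all add: r_def s_def)
  then have sum: "(1 - c) * (r + s) = c"
    by (simp add: algebra_simps)
  have "(2 * (1 - c) * r) * (2 * (1 - c) * s) = c\<^sup>2 - D"
    unfolding 2 using D by (simp add: algebra_simps power2_eq_square)
  then have "4 * (1 - c) * ((1 - c) * (r * s)) = 4 * (1 - c) * (- (1 + c))"
    by (simp add: D_def algebra_simps power2_eq_square)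
  then have prod: "(1 - c) * (r * s) = - (1 + c)"
    using c by simp
  have rs: "r \<noteq> 0" "s \<noteq> 0"
    using prod c by auto
  have nz: "of_real (1 - c) \<noteq> (0::complex)"
    using c by (simp only: of_real_eq_0_iff)
  have "t \<in> tilts c \<longleftrightarrow> t = of_real r \<or> t = of_real s" if "t \<noteq> 0" for t :: complex
  proof -
    have "t \<in> tilts c \<longleftrightarrow> t - inverse t = of_real c * (1 + t + inverse t)"
      using that by (simp add: tilts_def)
    also have "\<dots> \<longleftrightarrow> t * (t - inverse t) = t * (of_real c * (1 + t + inverse t))"
      using that by (simp only: mult_cancel_left simp_thms)
    also have "t * (t - inverse t) = t * t - 1"
      using that by (simp add: right_diff_distrib)
    also have "t * (of_real c * (1 + t + inverse t)) = of_real c * (t + t * t + 1)"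
      using that by (simp add: distrib_left)
    also have "t * t - 1 = of_real c * (t + t * t + 1)
        \<longleftrightarrow> of_real (1 - c) * (t * t) - of_real c * t - of_real (1 + c) = 0"
      by (simp add: algebra_simps)
    also have "of_real (1 - c) * (t * t) - of_real c * t - of_real (1 + c)
        = of_real (1 - c) * (t * t) - of_real ((1 - c) * (r + s)) * t + of_real ((1 - c) * (r * s))"
      unfolding sum prod by simp
    also have "\<dots> = of_real (1 - c) * ((t - of_real r) * (t - of_real s))"
      by (simp add: algebra_simps)
    also have "\<dots> = 0 \<longleftrightarrow> t = of_real r \<or> t = of_real s"
      using nz by (simp only: mult_eq_0_iff right_minus_eq simp_thms)
    finally show ?thesis .
  qed
  moreover have "0 \<notin> tilts c"
    by (simp add: tilts_def)
  ultimately have "t \<in> tilts c \<longleftrightarrow> t \<in> {of_real r, of_real s}" for t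
    using rs by (cases "t = 0") auto
  then have "tilts c = {of_real r, of_real s}"
    by blast
  then show ?thesis
    using \<open>r \<noteq> s\<close> by simp
qed

context prism_base
begin

definition marginal :: "((nat \<Rightarrow>\<^sub>0 int) \<Rightarrow> 'b::comm_monoid_add) \<Rightarrow> (nat \<Rightarrow>\<^sub>0 int) \<Rightarrow> 'b"
  where "marginal F = (\<lambda>a\<in>S. F (pt a (-1)) + F (pt a 0) + F (pt a 1))"

text \<open>The mean height of the data \<open>u\<close>, i.e. the right hand side of the last score equation.\<close>
definition tilt :: "((nat \<Rightarrow>\<^sub>0 int) \<Rightarrow> nat) \<Rightarrow> real"
  where "tilt u = (\<Sum>a\<in>S. real (u (pt a 1)) - real (u (pt a (-1)))) / real (\<Sum>b\<in>S'. u b)"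

lemma sum_marginal: "(\<Sum>a\<in>S. marginal F a) = (\<Sum>b\<in>S'. F b)"
  by (simp add: sum_prism_points marginal_def)

text \<open>Positivity of the data, which is a generic condition, keeps the mean height away from the
  extreme values \<open>-1\<close> and \<open>1\<close>, where one of the two tilts degenerates to \<open>0\<close> or \<open>\<infinity>\<close>.\<close>
lemma abs_tilt_less_1:
  assumes "\<And>b. b \<in> S' \<Longrightarrow> u b > 0"
  shows "\<bar>tilt u\<bar> < 1"
proof -
  have "(\<Sum>b\<in>S'. u b) = (\<Sum>a\<in>S. u (pt a (-1)) + u (pt a 0) + u (pt a 1))"
    by (rule sum_prism_points)
  then have N: "real (\<Sum>b\<in>S'. u b) = (\<Sum>a\<in>S. real (u (pt a (-1))) + real (u (pt a 0)) + real (u (pt a 1)))"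
    by simp
  have "\<bar>\<Sum>a\<in>S. real (u (pt a 1)) - real (u (pt a (-1)))\<bar>
      \<le> (\<Sum>a\<in>S. \<bar>real (u (pt a 1)) - real (u (pt a (-1)))\<bar>)"
    by (rule sum_abs)
  also have "\<dots> < real (\<Sum>b\<in>S'. u b)"
    unfolding N
  proof (intro sum_strict_mono finite_base nonempty_base)
    fix a assume "a \<in> S"
    then have "u (pt a (-1)) > 0" "u (pt a 0) > 0" "u (pt a 1) > 0"
      using assms by simp_all
    then show "\<bar>real (u (pt a 1)) - real (u (pt a (-1)))\<bar>
        < real (u (pt a (-1))) + real (u (pt a 0)) + real (u (pt a 1))"
      by linarith
  qed
  finally show ?thesis
    unfolding tilt_def by (simp only: abs_divide) (simp add: divide_less_eq)
qed

lemma moment_prism: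
  "j < d \<Longrightarrow> (\<Sum>b\<in>S'. of_int (Poly_Mapping.lookup b j) * F b)
    = (\<Sum>a\<in>S. of_int (Poly_Mapping.lookup a j) * marginal F a :: 'b::comm_ring_1)"
  by (simp add: sum_prism_points marginal_def lookup_pt distrib_left)

lemma moment_height:
  "(\<Sum>b\<in>S'. of_int (height b) * F b) = (\<Sum>a\<in>S. F (pt a 1) - F (pt a (-1)) :: 'b::comm_ring_1)"
  by (simp add: sum_prism_points)

text \<open>The score equations of the prism split into those of the base, for the marginal data, and
  one equation for the new coordinate.\<close>
lemma score_solutions_prism_iff:
  assumes "0 < (\<Sum>b\<in>S'. u b)"
  shows "p \<in> score_solutions (Suc d) S' u \<longleftrightarrow> p \<in> toric_variety (Suc d) S' \<and> (\<forall>b\<in>S'. p b \<noteq> 0) \<and>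
    (\<Sum>a\<in>S. marginal p a) = 1 \<and>
    (\<forall>j<d. (\<Sum>a\<in>S. of_int (Poly_Mapping.lookup a j) * marginal p a) =
      (\<Sum>a\<in>S. of_int (Poly_Mapping.lookup a j) * of_nat (marginal u a)) / of_nat (\<Sum>a\<in>S. marginal u a)) \<and>
    (\<Sum>a\<in>S. p (pt a 1) - p (pt a (-1))) = of_real (tilt u)"
proof -
  have "marginal (\<lambda>b. of_nat (u b) :: complex) a = of_nat (marginal u a)" if "a \<in> S" for a
    using that by (simp add: marginal_def)
  then have j: "(\<Sum>b\<in>S'. of_int (Poly_Mapping.lookup b j) * of_nat (u b))
      = (\<Sum>a\<in>S. of_int (Poly_Mapping.lookup a j) * of_nat (marginal u a) :: complex)" if "j < d" for j
    using that by (simp add: moment_prism)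
  have h: "(\<Sum>b\<in>S'. of_int (height b) * of_nat (u b)) / of_nat (\<Sum>b\<in>S'. u b) = (of_real (tilt u) :: complex)"
    by (simp add: moment_height tilt_def)
  show ?thesis
    unfolding score_solutions_iff[OF assms] less_Suc_eq sum_marginal
    using j moment_prism[of _ p] h moment_height[of p] by (auto simp: sum_marginal)
qed

lemma marginal_spread:
  assumes "1 + t + inverse t \<noteq> 0" "a \<in> S"
  shows "marginal (spread (inverse (1 + t + inverse t)) t p) a = p a"
proof -
  have "marginal (spread (inverse (1 + t + inverse t)) t p) a
      = inverse (1 + t + inverse t) * (1 + t + inverse t) * p a"
    unfolding marginal_def using assms(2) by (simp add: algebra_simps)
  then show ?thesis
    using assms(1) by simp
qed

text \<open>Every solution on the prism is the spread of its marginal, with \<open>t\<close> read off as the ratio of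
  its values at heights \<open>1\<close> and \<open>0\<close>.\<close>
lemma score_solutions_prism:
  assumes pos: "\<And>b. b \<in> S' \<Longrightarrow> u b > 0"
  shows "score_solutions (Suc d) S' u =
    (\<lambda>(p, t). spread (inverse (1 + t + inverse t)) t p) `
      (score_solutions d S (marginal u) \<times> tilts (tilt u))" (is "_ = ?R")
proof -
  obtain e where e: "e \<in> S"
    using nonempty_base by blast
  have "S' \<noteq> {}"
    using pt_in(1)[OF e] by blast
  then have N: "0 < (\<Sum>b\<in>S'. u b)"
    using pos by (intro sum_pos[OF finite_prism_points])
  then have N': "0 < (\<Sum>a\<in>S. marginal u a)"
    by (simp add: sum_marginal)
  show ?thesis
  proof (intro equalityI subsetI)
    fix q assume "q \<in> ?R"
    then obtain p t where p: "p \<in> score_solutions d S (marginal u)" and t: "t \<in> tilts (tilt u)"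
      and q: "q = spread (inverse (1 + t + inverse t)) t p"
      by auto
    define k where "k = 1 + t + inverse t"
    have k: "k \<noteq> 0" and t0: "t \<noteq> 0"
      using tilts_mass_nonzero[OF t] tilts_nonzero[OF t] by (auto simp: k_def)
    have q: "q = spread (inverse k) t p"
      by (simp add: q k_def)
    have m: "marginal q a = p a" if "a \<in> S" for a
      using marginal_spread[of t a p] k that by (simp add: q k_def)
    have p': "p \<in> toric_variety d S" "\<forall>a\<in>S. p a \<noteq> 0" "(\<Sum>a\<in>S. p a) = 1"
      using p by (simp_all add: score_solutions_iff[OF N'])
    have "q b \<noteq> 0" if "b \<in> S'" for b
      using that by (rule prism_points_cases) (use p' k t0 in \<open>simp_all add: q\<close>)
    moreover have "(\<Sum>a\<in>S. q (pt a 1) - q (pt a (-1))) = (\<Sum>a\<in>S. p a) * ((t - inverse t) * inverse k)"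
      unfolding sum_distrib_right by (rule sum.cong) (auto simp: q algebra_simps)
    then have "(\<Sum>a\<in>S. q (pt a 1) - q (pt a (-1))) = of_real (tilt u)"
      using t k p'(3) by (simp add: tilts_def k_def)
    moreover have "q \<in> toric_variety (Suc d) S'"
      unfolding q by (rule toric_variety_spread[OF p'(1)]) (use k t0 in auto)
    ultimately show "q \<in> score_solutions (Suc d) S' u"
      using p unfolding score_solutions_prism_iff[OF N] score_solutions_iff[OF N'] by (simp add: m)
  next
    fix q assume q: "q \<in> score_solutions (Suc d) S' u"
    note q' = q[unfolded score_solutions_prism_iff[OF N]]
    have nz: "q (pt a (-1)) \<noteq> 0" "q (pt a 0) \<noteq> 0" "q (pt a 1) \<noteq> 0" if "a \<in> S" for a
      using q' that by auto
    define t where "t = q (pt e 1) / q (pt e 0)"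
    define k where "k = 1 + t + inverse t"
    have t0: "t \<noteq> 0"
      using nz e by (simp add: t_def)
    have up: "q (pt a 1) = q (pt a 0) * t" if "a \<in> S" for a
      using toric_variety_prism_binomials(1)[of q a e] q' that e nz[OF e] by (simp add: t_def field_simps)
    have down: "q (pt a (-1)) = q (pt a 0) * inverse t" if "a \<in> S" for a
      using toric_variety_prism_binomials(2)[of q a] q' that nz[OF that] t0 up[OF that]
      by (simp add: power2_eq_square field_simps)
    have m: "marginal q a = k * q (pt a 0)" if "a \<in> S" for a
      using that by (simp add: marginal_def up down k_def algebra_simps)
    \<comment> \<open>The first score equation gives \<open>k \<noteq> 0\<close>, which is what allows \<open>q\<close> to be recovered from its
      marginal.\<close>
    have mass: "k * (\<Sum>a\<in>S. q (pt a 0)) = 1"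
      using q' m by (simp add: sum_distrib_left)
    then have k: "k \<noteq> 0"
      by auto
    define p where "p = (\<lambda>a\<in>S. k * q (pt a 0))"
    have pm: "p a = marginal q a" if "a \<in> S" for a
      using that by (simp add: p_def m)
    have "p \<in> toric_variety d S"
      unfolding p_def using q' k by (intro toric_variety_slice) auto
    moreover have "\<forall>a\<in>S. p a \<noteq> 0"
      using nz k by (simp add: p_def)
    ultimately have "p \<in> score_solutions d S (marginal u)"
      using q' unfolding score_solutions_iff[OF N'] by (simp add: pm)
    moreover have "t \<in> tilts (tilt u)"
    proof -
      have "of_real (tilt u) = (\<Sum>a\<in>S. q (pt a 1) - q (pt a (-1)))"
        using q' by simp
      also have "\<dots> = (t - inverse t) * (\<Sum>a\<in>S. q (pt a 0))"
        unfolding sum_distrib_left by (rule sum.cong) (auto simp: up down algebra_simps)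
      finally have tilt: "of_real (tilt u) = (t - inverse t) * (\<Sum>a\<in>S. q (pt a 0))" .
      have "of_real (tilt u) * k = (t - inverse t) * (k * (\<Sum>a\<in>S. q (pt a 0)))"
        unfolding tilt by (simp only: mult_ac)
      then have "of_real (tilt u) * k = t - inverse t"
        unfolding mass by simp
      then show ?thesis
        using t0 by (simp add: tilts_def k_def)
    qed
    moreover have "q = spread (inverse k) t p"
    proof (rule extensionalityI[of _ S'])
      show "q \<in> extensional S'"
        using toric_variety_extensional[of q "Suc d" S'] q' by (auto simp: PiE_def)
      show "spread (inverse k) t p \<in> extensional S'"
        by (simp add: spread_def)
      show "q b = spread (inverse k) t p b" if "b \<in> S'" for b
        using that by (rule prism_points_cases) (use k in \<open>simp_all add: p_def up down\<close>)
    qed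
    ultimately show "q \<in> ?R"
      unfolding k_def by force
  qed
qed

text \<open>Both \<open>p\<close>, as the marginal, and \<open>t\<close>, as a ratio of coordinates, can be recovered.\<close>
lemma inj_on_spread:
  "inj_on (\<lambda>(p, t). spread (inverse (1 + t + inverse t)) t p)
    (score_solutions d S v \<times> tilts c)"
proof (rule inj_onI, clarify, rule conjI)
  fix p t p' t'
  assume p: "p \<in> score_solutions d S v" "p' \<in> score_solutions d S v" and t: "t \<in> tilts c" "t' \<in> tilts c"
    and eq: "spread (inverse (1 + t + inverse t)) t p = spread (inverse (1 + t' + inverse t')) t' p'"
  have "p \<in> extensional S" "p' \<in> extensional S"
    using p toric_variety_extensional by (auto simp: score_solutions_def PiE_def)
  moreover have "p a = p' a" if "a \<in> S" for a
    using marginal_spread[OF tilts_mass_nonzero[OF t(1)] that, of p]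
      marginal_spread[OF tilts_mass_nonzero[OF t(2)] that, of p'] eq by simp
  ultimately show "p = p'"
    by (rule extensionalityI)
  obtain a where a: "a \<in> S"
    using nonempty_base by blast
  have ratio: "t = spread (inverse (1 + t + inverse t)) t p (pt a 1) / spread (inverse (1 + t + inverse t)) t p (pt a 0)"
    if "p \<in> score_solutions d S v" "t \<in> tilts c" for p t
    using that a tilts_mass_nonzero[OF that(2)] by (simp add: score_solutions_def)
  show "t = t'"
    using ratio[OF p(1) t(1)] ratio[OF p(2) t(2)] eq by simp
qed

lemma score_count_prism:
  assumes "\<And>b. b \<in> S' \<Longrightarrow> u b > 0"
  shows "card (score_solutions (Suc d) S' u) = 2 * card (score_solutions d S (marginal u))"
    and "finite (score_solutions (Suc d) S' u) \<longleftrightarrow> finite (score_solutions d S (marginal u))"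
proof -
  have two: "card (tilts (tilt u)) = 2"
    by (rule card_tilts[OF abs_tilt_less_1[OF assms]])
  then have "finite (tilts (tilt u))" "tilts (tilt u) \<noteq> {}"
    by (auto intro: card_ge_0_finite)
  moreover have "score_solutions (Suc d) S' u = (\<lambda>(p, t). spread (inverse (1 + t + inverse t)) t p) `
      (score_solutions d S (marginal u) \<times> tilts (tilt u))"
    by (rule score_solutions_prism) (rule assms)
  moreover note inj_on_spread[of "marginal u" "tilt u"]
  ultimately show "card (score_solutions (Suc d) S' u) = 2 * card (score_solutions d S (marginal u))"
    "finite (score_solutions (Suc d) S' u) \<longleftrightarrow> finite (score_solutions d S (marginal u))"
    using two by (auto simp: card_image card_cartesian_product finite_image_iff finite_cartesian_product_iff)
qed

section \<open>Generic score counts of a prism\<close>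

text \<open>The pull-back of the genericity condition along the marginal map, together with positivity of
  the data.\<close>
lemma generic_score_count_prismI:
  assumes "is_generic_score_count d S m"
  shows "is_generic_score_count (Suc d) S' (2 * m)"
proof -
  obtain g y where g: "polynomial_on S g" "g y \<noteq> 0"
    "\<And>u. u \<in> S \<rightarrow>\<^sub>E UNIV \<Longrightarrow> g (\<lambda>a. of_nat (u a)) \<noteq> 0 \<Longrightarrow>
      finite (score_solutions d S u) \<and> card (score_solutions d S u) = m"
    using assms unfolding is_generic_score_count_def for_generic_data_iff by auto
  define G where "G = (\<lambda>x. g (\<lambda>a. if a \<in> S then x (pt a (-1)) + x (pt a 0) + x (pt a 1) else 0))"
  have G: "polynomial_on S' G"
    unfolding G_def by (rule polynomial_on_compose[OF g(1)]) (auto intro!: polynomial_on_intros)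
  have E: "polynomial_on S' (\<lambda>x. \<Prod>b\<in>S'. x b)"
    by (intro polynomial_on_intros)
  \<comment> \<open>The marginal map is onto, so the condition pulled back along it does not vanish identically.\<close>
  have "G (\<lambda>b. if height b = 0 then y (base b) else 0) = g y"
    unfolding G_def by (rule polynomial_on_cong[OF g(1)]) simp
  then obtain z where "G z * (\<Prod>b\<in>S'. z b) \<noteq> 0"
    using polynomial_on_mult_nonzero[OF G E, of "\<lambda>b. if height b = 0 then y (base b) else 0" "\<lambda>_. 1"] g(2)
    by auto
  moreover have "finite (score_solutions (Suc d) S' u) \<and> card (score_solutions (Suc d) S' u) = 2 * m"
    if u: "G (\<lambda>b. of_nat (u b)) * (\<Prod>b\<in>S'. of_nat (u b)) \<noteq> 0" for u
  proof -
    have "G (\<lambda>b. of_nat (u b)) = g (\<lambda>a. of_nat (marginal u a))"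
      unfolding G_def by (rule polynomial_on_cong[OF g(1)]) (simp add: marginal_def)
    then have "finite (score_solutions d S (marginal u)) \<and> card (score_solutions d S (marginal u)) = m"
      using u by (intro g(3)) (auto simp: marginal_def)
    moreover have "u b > 0" if "b \<in> S'" for b
      using u that finite_prism_points by auto
    ultimately show ?thesis
      using score_count_prism[of u] by simp
  qed
  ultimately show ?thesis
    unfolding is_generic_score_count_def for_generic_data_iff
    using polynomial_on_mult[OF G E] by (intro exI[of _ "\<lambda>x. G x * (\<Prod>b\<in>S'. x b)"]) blast
qed

text \<open>Fix natural data \<open>w\<close> that are generic for the prism. Data \<open>u\<close> on the base are lifted by keeping
  the values of \<open>w\<close> at heights \<open>-1\<close> and \<open>1\<close> and adjusting those at height \<open>0\<close> so that the marginal
  is \<open>u\<close>. The lift is polynomial in \<open>u\<close> and equals \<open>w\<close> when \<open>u\<close> is the marginal of \<open>w\<close>, so it is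
  generic for generic \<open>u\<close>. It consists of positive natural numbers once \<open>u a\<close> exceeds
  \<open>w (a, -1) + w (a, 1)\<close>; for natural data this excludes only finitely many values of \<open>u a\<close> and so is
  again a generic condition.\<close>
lemma generic_score_count_prismD:
  assumes "is_generic_score_count (Suc d) S' m'"
  obtains m where "m' = 2 * m" "is_generic_score_count d S m"
proof -
  obtain g y where g: "polynomial_on S' g" "g y \<noteq> 0"
    "\<And>u. u \<in> S' \<rightarrow>\<^sub>E UNIV \<Longrightarrow> g (\<lambda>b. of_nat (u b)) \<noteq> 0 \<Longrightarrow>
      finite (score_solutions (Suc d) S' u) \<and> card (score_solutions (Suc d) S' u) = m'"
    using assms unfolding is_generic_score_count_def for_generic_data_iff by auto
  define G where "G x = g x * (\<Prod>b\<in>S'. x b)" for x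
  have E: "polynomial_on S' (\<lambda>x. \<Prod>b\<in>S'. x b)"
    by (intro polynomial_on_intros)
  have G: "polynomial_on S' G"
    unfolding G_def by (rule polynomial_on_mult[OF g(1) E])
  obtain z where "G z \<noteq> 0"
    using polynomial_on_mult_nonzero[OF g(1) E g(2), of "\<lambda>_. 1"] by (auto simp: G_def)
  then obtain w :: "(nat \<Rightarrow>\<^sub>0 int) \<Rightarrow> nat" where w: "w \<in> S' \<rightarrow>\<^sub>E UNIV" "G (\<lambda>b. of_nat (w b)) \<noteq> 0"
    by (rule polynomial_on_nat_point[OF finite_prism_points G])
  define r where "r a = w (pt a (-1)) + w (pt a 1)" for a
  define \<phi> :: "(nat \<Rightarrow>\<^sub>0 int) \<Rightarrow> ((nat \<Rightarrow>\<^sub>0 int) \<Rightarrow> complex) \<Rightarrow> complex"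
    where "\<phi> b = (if height b = 0 then (\<lambda>x. x (base b) - of_nat (r (base b))) else (\<lambda>x. of_nat (w b)))" for b
  \<comment> \<open>\<open>H\<close> expresses that the lift is generic, \<open>K\<close> that it is positive.\<close>
  define H where "H x = G (\<lambda>b. \<phi> b x)" for x
  define K :: "((nat \<Rightarrow>\<^sub>0 int) \<Rightarrow> complex) \<Rightarrow> complex"
    where "K x = (\<Prod>a\<in>S. \<Prod>i\<le>r a. x a - of_nat i)" for x
  have H: "polynomial_on S H"
    unfolding H_def by (rule polynomial_on_compose[OF G]) (auto simp: \<phi>_def base_in intro!: polynomial_on_intros)
  have K: "polynomial_on S K"
    unfolding K_def by (intro polynomial_on_intros)
  have "H (\<lambda>a. of_nat (marginal w a)) = G (\<lambda>b. of_nat (w b))"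
    unfolding H_def
  proof (rule polynomial_on_cong[OF G])
    show "\<phi> b (\<lambda>a. of_nat (marginal w a)) = of_nat (w b)" if "b \<in> S'" for b
      using that by (rule prism_points_cases) (auto simp: \<phi>_def marginal_def r_def)
  qed
  moreover have "K (\<lambda>a. of_nat (Suc (r a))) \<noteq> 0"
    unfolding K_def using finite_base by (auto simp del: of_nat_Suc)
  ultimately obtain x where x: "H x * K x \<noteq> 0"
    using polynomial_on_mult_nonzero[OF H K] w(2) by metis
  have count: "finite (score_solutions d S u)" "2 * card (score_solutions d S u) = m'"
    if u: "u \<in> S \<rightarrow>\<^sub>E UNIV" "H (\<lambda>a. of_nat (u a)) * K (\<lambda>a. of_nat (u a)) \<noteq> 0" for u
  proof -
    have large: "r a < u a" if "a \<in> S" for a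
    proof (rule ccontr)
      assume "\<not> r a < u a"
      then have "(\<Prod>i\<le>r a. of_nat (u a) - of_nat i) = (0::complex)"
        by (intro prod_zero) auto
      then have "K (\<lambda>a. of_nat (u a)) = 0"
        unfolding K_def using that finite_base by (intro prod_zero) auto
      then show False
        using u(2) by simp
    qed
    define v where "v = (\<lambda>b\<in>S'. if height b = 0 then u (base b) - r (base b) else w b)"
    have "\<phi> b (\<lambda>a. of_nat (u a)) = of_nat (v b)" if "b \<in> S'" for b
      using that by (rule prism_points_cases) (use large in \<open>auto simp: \<phi>_def v_def of_nat_diff less_imp_le\<close>)
    then have "H (\<lambda>a. of_nat (u a)) = G (\<lambda>b. of_nat (v b))"
      unfolding H_def by (rule polynomial_on_cong[OF G])
    then have v: "G (\<lambda>b. of_nat (v b)) \<noteq> 0"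
      using u(2) by auto
    have pos: "v b > 0" if "b \<in> S'" for b
      using v that finite_prism_points by (auto simp: G_def)
    have "v \<in> S' \<rightarrow>\<^sub>E UNIV"
      by (simp add: v_def)
    then have fin: "finite (score_solutions (Suc d) S' v)" "card (score_solutions (Suc d) S' v) = m'"
      using g(3) v by (auto simp: G_def)
    have "marginal v = u"
    proof (rule extensionalityI[of _ S])
      show "marginal v a = u a" if "a \<in> S" for a
        using large[OF that] that by (simp add: marginal_def v_def r_def)
    qed (use u(1) in \<open>auto simp: marginal_def PiE_def\<close>)
    then show "finite (score_solutions d S u)" "2 * card (score_solutions d S u) = m'"
      using score_count_prism[OF pos] fin by simp_all
  qed
  have HK: "polynomial_on S (\<lambda>x. H x * K x)"
    by (rule polynomial_on_mult[OF H K])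
  obtain u :: "(nat \<Rightarrow>\<^sub>0 int) \<Rightarrow> nat" where "u \<in> S \<rightarrow>\<^sub>E UNIV" "H (\<lambda>a. of_nat (u a)) * K (\<lambda>a. of_nat (u a)) \<noteq> 0"
    using x by (rule polynomial_on_nat_point[OF finite_base HK])
  then have even: "m' = 2 * card (score_solutions d S u)"
    using count(2) by simp
  have "is_generic_score_count d S (card (score_solutions d S u))"
    unfolding is_generic_score_count_def for_generic_data_iff
  proof (intro exI[of _ "\<lambda>x. H x * K x"] conjI HK ballI impI)
    show "\<exists>x. H x * K x \<noteq> 0"
      using x by blast
  qed (use count even in auto)
  with even show thesis
    by (rule that)
qed

end

section \<open>Lattice points of iterated prisms\<close>

lemma lookup_of_int_vec [simp]:
  "Poly_Mapping.lookup (of_int_vec a) i = of_int (Poly_Mapping.lookup a i)"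
  by (simp add: Poly_Mapping.map.rep_eq when_def)

lemma of_int_vec_add: "of_int_vec (a + b) = of_int_vec a + of_int_vec b"
  by (intro poly_mapping_eqI) (simp add: lookup_add)

lemma keys_of_int_vec: "Poly_Mapping.keys (of_int_vec a) = Poly_Mapping.keys a"
  by (auto simp: in_keys_iff)

lemma lattice_points_prism:
  assumes "\<And>x. x \<in> Q \<Longrightarrow> Poly_Mapping.keys x \<subseteq> {..<d}"
  shows "lattice_points (prism d Q) = prism_points d (lattice_points Q)"
proof (intro equalityI subsetI)
  fix b assume "b \<in> lattice_points (prism d Q)"
  then obtain x t where x: "x \<in> Q" "t \<in> {-1..1}" "of_int_vec b = x + Poly_Mapping.single d t"
    by (auto simp: lattice_points_def prism_def)
  define j where "j = Poly_Mapping.lookup b d"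
  have "Poly_Mapping.lookup x d = 0"
    using assms[OF x(1)] by (auto simp: in_keys_iff)
  then have t: "t = of_int j"
    using arg_cong[OF x(3), of "\<lambda>y. Poly_Mapping.lookup y d"] by (simp add: lookup_add j_def)
  then have "-1 \<le> j" "j \<le> 1"
    using x(2) by auto
  then have j: "j \<in> {-1, 0, 1}"
    by auto
  have b: "b = prism_point d (b - Poly_Mapping.single d j) j"
    by (simp add: prism_point_def)
  have "of_int_vec (b - Poly_Mapping.single d j) + Poly_Mapping.single d t = of_int_vec b"
    using of_int_vec_add[of "b - Poly_Mapping.single d j" "Poly_Mapping.single d j"] by (simp add: t)
  then have "of_int_vec (b - Poly_Mapping.single d j) = x"
    using x(3) by simp
  then have "b - Poly_Mapping.single d j \<in> lattice_points Q"
    using x(1) by (simp add: lattice_points_def)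
  then show "b \<in> prism_points d (lattice_points Q)"
    unfolding prism_points_def using b j by blast
next
  fix b assume "b \<in> prism_points d (lattice_points Q)"
  then obtain a j where "a \<in> lattice_points Q" "j \<in> {-1, 0, 1}" "b = prism_point d a j"
    by (auto simp: prism_points_def)
  then have "of_int_vec a \<in> Q" "(of_int j :: real) \<in> {-1..1}"
    "of_int_vec b = of_int_vec a + Poly_Mapping.single d (of_int j)"
    by (auto simp: lattice_points_def prism_point_def of_int_vec_add)
  then show "b \<in> lattice_points (prism d Q)"
    unfolding lattice_points_def prism_def by blast
qed

lemma keys_prism:
  assumes "\<And>x. x \<in> Q \<Longrightarrow> Poly_Mapping.keys x \<subseteq> {..<d}" "y \<in> prism d Q"
  shows "Poly_Mapping.keys y \<subseteq> {..<Suc d}"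
proof -
  obtain x t where "x \<in> Q" "y = x + Poly_Mapping.single d t"
    using assms(2) by (auto simp: prism_def)
  then show ?thesis
    using assms(1)[of x] Poly_Mapping.keys_add[of x "Poly_Mapping.single d t"]
    by (fastforce split: if_splits)
qed

lemma prism_base_lattice_points:
  assumes "\<And>x. x \<in> Q \<Longrightarrow> Poly_Mapping.keys x \<subseteq> {..<d}"
    and "finite (lattice_points Q)" "lattice_points Q \<noteq> {}"
  shows "prism_base d (lattice_points Q)"
proof
  show "Poly_Mapping.keys a \<subseteq> {..<d}" if "a \<in> lattice_points Q" for a
    using assms(1)[of "of_int_vec a"] that unfolding lattice_points_def keys_of_int_vec by blast
qed (rule assms(2,3))+

text \<open>Since generic counts of the base and of the prism exist simultaneously, the conventional value
  \<open>0\<close> is doubled as well.\<close>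
lemma mldeg_prism:
  assumes keys: "\<And>x. x \<in> Q \<Longrightarrow> Poly_Mapping.keys x \<subseteq> {..<d}"
    and "finite (lattice_points Q)" "lattice_points Q \<noteq> {}"
  shows "mldeg (Suc d) (prism d Q) = 2 * mldeg d Q"
proof -
  interpret prism_base d "lattice_points Q"
    by (rule prism_base_lattice_points[OF assms])
  have the: "mldeg e R = m" if "is_generic_score_count e (lattice_points R) m" "finite (lattice_points R)" for e R m
  proof -
    have "(THE n. is_generic_score_count e (lattice_points R) n) = m"
      using that(1) by (rule the_equality) (rule generic_score_count_unique[OF that(2) _ that(1)])
    then show ?thesis
      using that(1) by (auto simp: mldeg_def)
  qed
  have L: "lattice_points (prism d Q) = S'"
    by (rule lattice_points_prism[OF keys])
  show ?thesis
  proof (cases "\<exists>m. is_generic_score_count d (lattice_points Q) m")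
    case True
    then obtain m where m: "is_generic_score_count d (lattice_points Q) m"
      by blast
    have "mldeg (Suc d) (prism d Q) = 2 * m"
      by (rule the) (simp_all add: L finite_prism_points generic_score_count_prismI[OF m])
    then show ?thesis
      using the[OF m assms(2)] by simp
  next
    case False
    then have "\<nexists>m. is_generic_score_count (Suc d) S' m"
      by (metis generic_score_count_prismD)
    then show ?thesis
      using False by (simp add: mldeg_def L)
  qed
qed

lemma mldeg_iterated_prism:
  assumes "\<And>x. x \<in> Q \<Longrightarrow> Poly_Mapping.keys x \<subseteq> {..<d}"
    and "finite (lattice_points Q)" "lattice_points Q \<noteq> {}"
  shows "mldeg (d + k) (iterated_prism k d Q) = 2 ^ k * mldeg d Q"
proof -
  have "(\<forall>x\<in>iterated_prism k d Q. Poly_Mapping.keys x \<subseteq> {..<d + k}) \<and>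
    finite (lattice_points (iterated_prism k d Q)) \<and> lattice_points (iterated_prism k d Q) \<noteq> {} \<and>
    mldeg (d + k) (iterated_prism k d Q) = 2 ^ k * mldeg d Q"
  proof (induction k)
    case 0
    then show ?case
      using assms by auto
  next
    case (Suc k)
    let ?Q = "iterated_prism k d Q"
    have keys: "\<And>x. x \<in> ?Q \<Longrightarrow> Poly_Mapping.keys x \<subseteq> {..<d + k}"
      and fin: "finite (lattice_points ?Q)" "lattice_points ?Q \<noteq> {}"
      using Suc by auto
    interpret prism_base "d + k" "lattice_points ?Q"
      by (rule prism_base_lattice_points[OF keys fin])
    have "\<forall>x\<in>prism (d + k) ?Q. Poly_Mapping.keys x \<subseteq> {..<Suc (d + k)}"
      using keys_prism[OF keys] by blast
    moreover have "finite S'" "S' \<noteq> {}"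
      using finite_prism_points pt_in(1) fin(2) by blast+
    moreover have "mldeg (Suc (d + k)) (prism (d + k) ?Q) = 2 ^ Suc k * mldeg d Q"
      using mldeg_prism[OF keys fin] Suc by simp
    ultimately show ?case
      by (simp add: lattice_points_prism[OF keys])
  qed
  then show ?thesis
    by blast
qed

lemma lookup_scaleR: "Poly_Mapping.lookup (r *\<^sub>R x) i = r *\<^sub>R Poly_Mapping.lookup x i"
proof -
  have "finite {i. r *\<^sub>R Poly_Mapping.lookup x i \<noteq> 0}"
    by (rule finite_subset[OF _ finite_keys[of x]]) (auto simp: in_keys_iff)
  then show ?thesis
    unfolding scaleR_poly_mapping_def by (simp only: lookup_Abs_poly_mapping)
qed

lemma lattice_polytope_keys:
  assumes "lattice_polytope d P" "x \<in> P"
  shows "Poly_Mapping.keys x \<subseteq> {..<d}"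
proof -
  obtain W where W: "\<forall>w\<in>W. Poly_Mapping.keys w \<subseteq> {..<d}" "P = convex hull (of_int_vec ` W)"
    using assms(1) by (auto simp: lattice_polytope_def)
  define C where "C = {x :: nat \<Rightarrow>\<^sub>0 real. \<forall>i\<ge>d. Poly_Mapping.lookup x i = 0}"
  have "convex C"
    by (auto simp: convex_def C_def lookup_add lookup_scaleR)
  moreover have "of_int_vec ` W \<subseteq> C"
    using W(1) by (force simp: C_def in_keys_iff subset_iff)
  ultimately have "P \<subseteq> C"
    unfolding W(2) by (rule hull_minimal[rotated])
  then have x: "Poly_Mapping.lookup x i = 0" if "i \<ge> d" for i
    using assms(2) that unfolding C_def by blast
  show ?thesis
  proof
    fix i assume "i \<in> Poly_Mapping.keys x"
    then have "\<not> d \<le> i"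
      using x[of i] by (auto simp: in_keys_iff)
    then show "i \<in> {..<d}"
      by simp
  qed
qed

lemma finite_lattice_points:
  assumes "lattice_polytope d P"
  shows "finite (lattice_points P)"
proof -
  obtain W where W: "finite W" "P = convex hull (of_int_vec ` W)"
    using assms by (auto simp: lattice_polytope_def)
  \<comment> \<open>A crude integer bound for all coordinates of the vertices. The box that it defines is convex, so it
  contains \<open>P\<close>.\<close>
  define B where "B = (\<Sum>w\<in>W. \<Sum>i\<in>Poly_Mapping.keys w. \<bar>Poly_Mapping.lookup w i\<bar>)"
  have bound: "\<bar>Poly_Mapping.lookup w i\<bar> \<le> B" if "w \<in> W" for w i
  proof -
    have "\<bar>Poly_Mapping.lookup w i\<bar> \<le> (\<Sum>i\<in>Poly_Mapping.keys w. \<bar>Poly_Mapping.lookup w i\<bar>)"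
      by (cases "i \<in> Poly_Mapping.keys w") (auto intro: member_le_sum sum_nonneg simp: in_keys_iff)
    also have "\<dots> \<le> B"
      unfolding B_def
      by (rule member_le_sum[OF that, of "\<lambda>w. \<Sum>i\<in>Poly_Mapping.keys w. \<bar>Poly_Mapping.lookup w i\<bar>"])
        (auto intro: sum_nonneg W(1))
    finally show ?thesis .
  qed
  define C where "C = {x :: nat \<Rightarrow>\<^sub>0 real. \<forall>i. Poly_Mapping.lookup x i \<in> {- of_int B..of_int B}}"
  have "convex C"
    unfolding convex_def
  proof (intro ballI allI impI)
    fix x y :: "nat \<Rightarrow>\<^sub>0 real" and s t :: real
    assume *: "x \<in> C" "y \<in> C" "0 \<le> s" "0 \<le> t" "s + t = 1"
    have "s *\<^sub>R Poly_Mapping.lookup x i + t *\<^sub>R Poly_Mapping.lookup y i \<in> {- of_int B..of_int B}" for i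
      by (rule convexD[OF convex_real_interval(5)]) (use * in \<open>auto simp: C_def\<close>)
    then show "s *\<^sub>R x + t *\<^sub>R y \<in> C"
      by (simp add: C_def lookup_add lookup_scaleR)
  qed
  moreover have "of_int_vec w \<in> C" if "w \<in> W" for w
  proof -
    have "- B \<le> Poly_Mapping.lookup w i \<and> Poly_Mapping.lookup w i \<le> B" for i
      using bound[OF that, of i] by linarith
    then show ?thesis
      unfolding C_def by (simp del: of_int_minus flip: of_int_minus)
  qed
  then have "of_int_vec ` W \<subseteq> C"
    by blast
  ultimately have "P \<subseteq> C"
    unfolding W(2) by (rule hull_minimal[rotated])
  have "lattice_points P \<subseteq> {a. \<forall>i. (i \<in> {..<d} \<longrightarrow> Poly_Mapping.lookup a i \<in> {- B..B}) \<and>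
      (i \<notin> {..<d} \<longrightarrow> Poly_Mapping.lookup a i = 0)}" (is "_ \<subseteq> ?A")
  proof
    fix a assume "a \<in> lattice_points P"
    then have a: "of_int_vec a \<in> P"
      by (simp add: lattice_points_def)
    have "of_int_vec a \<in> C"
      using a \<open>P \<subseteq> C\<close> by blast
    then have "Poly_Mapping.lookup a i \<in> {-B..B}" for i
      by (simp add: C_def) (metis of_int_le_iff of_int_minus)
    moreover have "Poly_Mapping.keys a \<subseteq> {..<d}"
      using lattice_polytope_keys[OF assms a] by (simp add: keys_of_int_vec)
    ultimately show "a \<in> ?A"
      by (auto simp: in_keys_iff subset_iff)
  qed
  moreover have "finite ?A"
  proof (rule finite_imageD[of Poly_Mapping.lookup])
    show "finite (Poly_Mapping.lookup ` ?A)"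
      by (rule finite_subset[OF _ finite_set_of_finite_funs[of "{..<d}" "{-B..B}" 0]]) auto
    show "inj_on Poly_Mapping.lookup ?A"
      by (auto intro: inj_onI poly_mapping_eqI)
  qed
  ultimately show ?thesis
    by (rule finite_subset)
qed

lemma lattice_points_nonempty:
  assumes "lattice_polytope d P" "has_aff_dim P d"
  shows "lattice_points P \<noteq> {}"
proof -
  obtain B where B: "affine hull B = affine hull P" "card B = d + 1"
    using assms(2) unfolding has_aff_dim_def by blast
  then have "B \<noteq> {}"
    by auto
  then have "P \<noteq> {}"
    using B(1) hull_subset[of B affine] by auto
  obtain W where W: "P = convex hull (of_int_vec ` W)"
    using assms(1) by (auto simp: lattice_polytope_def)
  with \<open>P \<noteq> {}\<close> obtain w where "w \<in> W"
    by (metis convex_hull_empty equals0I image_empty)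
  then have "of_int_vec w \<in> P"
    unfolding W by (intro hull_inc) auto
  then show ?thesis
    by (auto simp: lattice_points_def)
qed

theorem corollary7p5:
  fixes P :: "(nat \<Rightarrow>\<^sub>0 real) set" and d k :: nat
  assumes "d \<ge> 1"
    and "lattice_polytope d P"
    and "has_aff_dim P d"
  shows "mldeg (d + k) (iterated_prism k d P) = 2 ^ k * mldeg d P"
  using mldeg_iterated_prism[OF lattice_polytope_keys[OF assms(2)] finite_lattice_points[OF assms(2)]
    lattice_points_nonempty[OF assms(2,3)]] .

end
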